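(* Let $P(x)$ be a quantifier-free and disjunction-free formula and $\varphi(x,y)$ a quantifier-free formula of classical Tarski geometry with Skolem functions ($x$ may stand for several variables). If classical Tarski geometry with Skolem functions proves $P(x)\to\exists y\,\varphi(x,y)$, then there are finitely many terms $t_1(x),\dots,t_n(x)$ such that it also proves $P(x)\to\varphi(x,t_1(x))\lor\dots\lor\varphi(x,t_n(x))$.
   Context: Language: one sort (points), equality, strict betweenness $B(a,b,c)$, congruence $E(a,b,c,d)$ written $ab=cd$, constants $\alpha,\beta,\gamma$, and (total) function symbols $ext$ (4-ary), $ip$ (5-ary), $center$ (3-ary), $ilc_1,ilc_2$ (4-ary). Abbreviations: $T(a,b,c):=\neg(a\neq b\land b\neq c\land\neg B(a,b,c))$; $Col(a,b,c):=\neg(\neg T(c,a,b)\land\neg T(a,c,b)\land\neg T(a,b,c))$; $SameOrder(a,b,c,d):=(T(c,a,b)\to\neg B(d,c,a))\land(T(a,c,b)\to\neg B(d,c,b))\land(T(a,b,c)\to T(a,c,d))$. Classical Tarski geometry with Skolem functions is the theory with classical predicate logic with equality and the quantifier-free axioms: (A1) $ab=ba$; (A2) $ab=pq\land ab=rs\to pq=rs$; (A3) $ab=cc\to a=b$; (A4-i) $q\neq a\to T(q,a,x)\land ax=bc$ with $x=ext(q,a,b,c)$; (A5) $a\neq b\land T(a,b,c)\land T(A,B,C)\land ab=AB\land bc=BC\land ad=AD\land bd=BD\to cd=CD$; (A6-i) $\neg B(a,b,a)$; (A7-i) $B(a,p,c)\land T(b,q,c)\land\neg Col(a,b,c)\to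 T(p,x,b)\land T(q,x,a)$ with $x=ip(a,p,c,b,q)$; (A8) $\neg Col(\alpha,\beta,\gamma)$; (A9) $a\neq b\land pa=pb\land qa=qb\land ra=rb\to Col(p,q,r)$; (A10$_3$) $\neg Col(a,b,c)\to ax=bx\land ax=cx$ with $x=center(a,b,c)$; (A14-i) $B(a,b,c)\to B(c,b,a)$; (A15-i) $B(a,b,d)\land B(b,c,d)\to B(a,b,c)$; two-point line-circle: with $y=ilc_1(u,v,a,b)$, $z=ilc_2(u,v,a,b)$: $Col(u,v,p)\land u\neq v\land T(a,p,b)\to Col(u,v,y)\land Col(u,v,z)\land ay=ab\land az=ab\land T(y,p,z)\land(p\neq b\to y\neq z)$, and $u\neq v\to SameOrder(u,v,y,z)$. *)

theory Defs
  imports Main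
begin

section \<open>Syntax\<close>

text \<open>Terms and formulas of Tarski geometry with Skolem functions. Variables are de Bruijn
  indices: inside the scope of a quantifier, index \<open>0\<close> is the bound variable and index
  \<open>Suc i\<close> is the variable called \<open>i\<close> outside. Negation is implication of falsity.\<close>

datatype tm =
    Var nat
  | Alpha | Beta | Gamma
  | Ext tm tm tm tm
  | Ip tm tm tm tm tm
  | Center tm tm tm
  | Ilc1 tm tm tm tm
  | Ilc2 tm tm tm tm

datatype fm =
    Eq tm tm  (infix \<open>\<^bold>=\<close> 75)
  | Btw tm tm tm
  | Cong tm tm tm tm
  | Falsum  (\<open>\<^bold>\<bottom>\<close>)
  | And fm fm  (infixr \<open>\<^bold>\<and>\<close> 70)
  | Or fm fm  (infixr \<open>\<^bold>\<or>\<close> 65)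
  | Imp fm fm  (infixr \<open>\<^bold>\<longrightarrow>\<close> 60)
  | Forall fm
  | Exists fm

abbreviation Neg :: "fm \<Rightarrow> fm"  (\<open>\<^bold>\<not> _\<close> [74] 74)
  where "\<^bold>\<not> p \<equiv> p \<^bold>\<longrightarrow> \<^bold>\<bottom>"

abbreviation Neq :: "tm \<Rightarrow> tm \<Rightarrow> fm"  (infix \<open>\<^bold>\<noteq>\<close> 75)
  where "s \<^bold>\<noteq> t \<equiv> \<^bold>\<not> (s \<^bold>= t)"

primrec fv_tm :: "tm \<Rightarrow> nat set" where
  "fv_tm (Var i) = {i}"
| "fv_tm Alpha = {}"
| "fv_tm Beta = {}"
| "fv_tm Gamma = {}"
| "fv_tm (Ext a b c d) = fv_tm a \<union> fv_tm b \<union> fv_tm c \<union> fv_tm d"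
| "fv_tm (Ip a b c d e) = fv_tm a \<union> fv_tm b \<union> fv_tm c \<union> fv_tm d \<union> fv_tm e"
| "fv_tm (Center a b c) = fv_tm a \<union> fv_tm b \<union> fv_tm c"
| "fv_tm (Ilc1 a b c d) = fv_tm a \<union> fv_tm b \<union> fv_tm c \<union> fv_tm d"
| "fv_tm (Ilc2 a b c d) = fv_tm a \<union> fv_tm b \<union> fv_tm c \<union> fv_tm d"

primrec fv :: "fm \<Rightarrow> nat set" where
  "fv (s \<^bold>= t) = fv_tm s \<union> fv_tm t"
| "fv (Btw a b c) = fv_tm a \<union> fv_tm b \<union> fv_tm c"
| "fv (Cong a b c d) = fv_tm a \<union> fv_tm b \<union> fv_tm c \<union> fv_tm d"
| "fv \<^bold>\<bottom> = {}"
| "fv (p \<^bold>\<and> q) = fv p \<union> fv q"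
| "fv (p \<^bold>\<or> q) = fv p \<union> fv q"
| "fv (p \<^bold>\<longrightarrow> q) = fv p \<union> fv q"
| "fv (Forall p) = {i. Suc i \<in> fv p}"
| "fv (Exists p) = {i. Suc i \<in> fv p}"

primrec quantifier_free :: "fm \<Rightarrow> bool" where
  "quantifier_free (s \<^bold>= t) = True"
| "quantifier_free (Btw a b c) = True"
| "quantifier_free (Cong a b c d) = True"
| "quantifier_free \<^bold>\<bottom> = True"
| "quantifier_free (p \<^bold>\<and> q) = (quantifier_free p \<and> quantifier_free q)"
| "quantifier_free (p \<^bold>\<or> q) = (quantifier_free p \<and> quantifier_free q)"
| "quantifier_free (p \<^bold>\<longrightarrow> q) = (quantifier_free p \<and> quantifier_free q)"
| "quantifier_free (Forall p) = False"
| "quantifier_free (Exists p) = False"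

primrec disjunction_free :: "fm \<Rightarrow> bool" where
  "disjunction_free (s \<^bold>= t) = True"
| "disjunction_free (Btw a b c) = True"
| "disjunction_free (Cong a b c d) = True"
| "disjunction_free \<^bold>\<bottom> = True"
| "disjunction_free (p \<^bold>\<and> q) = (disjunction_free p \<and> disjunction_free q)"
| "disjunction_free (p \<^bold>\<or> q) = False"
| "disjunction_free (p \<^bold>\<longrightarrow> q) = (disjunction_free p \<and> disjunction_free q)"
| "disjunction_free (Forall p) = disjunction_free p"
| "disjunction_free (Exists p) = disjunction_free p"

text \<open>Capture-avoiding simultaneous substitution.\<close>

primrec subst_tm :: "(nat \<Rightarrow> tm) \<Rightarrow> tm \<Rightarrow> tm" where
  "subst_tm \<sigma> (Var i) = \<sigma> i"
| "subst_tm \<sigma> Alpha = Alpha"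
| "subst_tm \<sigma> Beta = Beta"
| "subst_tm \<sigma> Gamma = Gamma"
| "subst_tm \<sigma> (Ext a b c d) =
    Ext (subst_tm \<sigma> a) (subst_tm \<sigma> b) (subst_tm \<sigma> c) (subst_tm \<sigma> d)"
| "subst_tm \<sigma> (Ip a b c d e) =
    Ip (subst_tm \<sigma> a) (subst_tm \<sigma> b) (subst_tm \<sigma> c) (subst_tm \<sigma> d) (subst_tm \<sigma> e)"
| "subst_tm \<sigma> (Center a b c) = Center (subst_tm \<sigma> a) (subst_tm \<sigma> b) (subst_tm \<sigma> c)"
| "subst_tm \<sigma> (Ilc1 a b c d) =
    Ilc1 (subst_tm \<sigma> a) (subst_tm \<sigma> b) (subst_tm \<sigma> c) (subst_tm \<sigma> d)"
| "subst_tm \<sigma> (Ilc2 a b c d) =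
    Ilc2 (subst_tm \<sigma> a) (subst_tm \<sigma> b) (subst_tm \<sigma> c) (subst_tm \<sigma> d)"

definition under_binder :: "(nat \<Rightarrow> tm) \<Rightarrow> nat \<Rightarrow> tm" where
  "under_binder \<sigma> i = (case i of 0 \<Rightarrow> Var 0 | Suc j \<Rightarrow> subst_tm (\<lambda>k. Var (Suc k)) (\<sigma> j))"

primrec subst :: "(nat \<Rightarrow> tm) \<Rightarrow> fm \<Rightarrow> fm" where
  "subst \<sigma> (s \<^bold>= t) = (subst_tm \<sigma> s \<^bold>= subst_tm \<sigma> t)"
| "subst \<sigma> (Btw a b c) = Btw (subst_tm \<sigma> a) (subst_tm \<sigma> b) (subst_tm \<sigma> c)"
| "subst \<sigma> (Cong a b c d) =
    Cong (subst_tm \<sigma> a) (subst_tm \<sigma> b) (subst_tm \<sigma> c) (subst_tm \<sigma> d)"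
| "subst \<sigma> \<^bold>\<bottom> = \<^bold>\<bottom>"
| "subst \<sigma> (p \<^bold>\<and> q) = subst \<sigma> p \<^bold>\<and> subst \<sigma> q"
| "subst \<sigma> (p \<^bold>\<or> q) = subst \<sigma> p \<^bold>\<or> subst \<sigma> q"
| "subst \<sigma> (p \<^bold>\<longrightarrow> q) = subst \<sigma> p \<^bold>\<longrightarrow> subst \<sigma> q"
| "subst \<sigma> (Forall p) = Forall (subst (under_binder \<sigma>) p)"
| "subst \<sigma> (Exists p) = Exists (subst (under_binder \<sigma>) p)"

text \<open>\<open>shift p\<close> is \<open>p\<close> moved below one more binder; \<open>inst p t\<close> replaces index \<open>0\<close>
  of the body \<open>p\<close> of a quantifier by \<open>t\<close> and removes the binder.\<close>

definition shift :: "fm \<Rightarrow> fm" where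
  "shift = subst (\<lambda>i. Var (Suc i))"

definition inst :: "fm \<Rightarrow> tm \<Rightarrow> fm"  (\<open>_\<langle>_\<rangle>\<close> [90, 0] 91) where
  "p\<langle>t\<rangle> = subst (case_nat t Var) p"

fun big_or :: "fm list \<Rightarrow> fm" where
  "big_or [] = \<^bold>\<bottom>"
| "big_or [p] = p"
| "big_or (p # ps) = p \<^bold>\<or> big_or ps"


section \<open>Classical predicate logic with equality\<close>

inductive derivable :: "fm set \<Rightarrow> fm \<Rightarrow> bool"  (infix \<open>\<turnstile>\<close> 50) where
  Assm: "p \<in> \<Gamma> \<Longrightarrow> \<Gamma> \<turnstile> p"
| Classical: "insert (\<^bold>\<not> p) \<Gamma> \<turnstile> \<^bold>\<bottom> \<Longrightarrow> \<Gamma> \<turnstile> p"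
| AndI: "\<Gamma> \<turnstile> p \<Longrightarrow> \<Gamma> \<turnstile> q \<Longrightarrow> \<Gamma> \<turnstile> p \<^bold>\<and> q"
| AndE1: "\<Gamma> \<turnstile> p \<^bold>\<and> q \<Longrightarrow> \<Gamma> \<turnstile> p"
| AndE2: "\<Gamma> \<turnstile> p \<^bold>\<and> q \<Longrightarrow> \<Gamma> \<turnstile> q"
| OrI1: "\<Gamma> \<turnstile> p \<Longrightarrow> \<Gamma> \<turnstile> p \<^bold>\<or> q"
| OrI2: "\<Gamma> \<turnstile> q \<Longrightarrow> \<Gamma> \<turnstile> p \<^bold>\<or> q"
| OrE: "\<Gamma> \<turnstile> p \<^bold>\<or> q \<Longrightarrow> insert p \<Gamma> \<turnstile> r \<Longrightarrow> insert q \<Gamma> \<turnstile> r \<Longrightarrow> \<Gamma> \<turnstile> r"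
| ImpI: "insert p \<Gamma> \<turnstile> q \<Longrightarrow> \<Gamma> \<turnstile> p \<^bold>\<longrightarrow> q"
| ImpE: "\<Gamma> \<turnstile> p \<^bold>\<longrightarrow> q \<Longrightarrow> \<Gamma> \<turnstile> p \<Longrightarrow> \<Gamma> \<turnstile> q"
| ForallI: "shift ` \<Gamma> \<turnstile> p \<Longrightarrow> \<Gamma> \<turnstile> Forall p"
| ForallE: "\<Gamma> \<turnstile> Forall p \<Longrightarrow> \<Gamma> \<turnstile> p\<langle>t\<rangle>"
| ExistsI: "\<Gamma> \<turnstile> p\<langle>t\<rangle> \<Longrightarrow> \<Gamma> \<turnstile> Exists p"
| ExistsE: "\<Gamma> \<turnstile> Exists p \<Longrightarrow> insert p (shift ` \<Gamma>) \<turnstile> shift q \<Longrightarrow> \<Gamma> \<turnstile> q"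
| EqI: "\<Gamma> \<turnstile> t \<^bold>= t"
| EqE: "\<Gamma> \<turnstile> s \<^bold>= t \<Longrightarrow> \<Gamma> \<turnstile> p\<langle>s\<rangle> \<Longrightarrow> \<Gamma> \<turnstile> p\<langle>t\<rangle>"


section \<open>Classical Tarski geometry with Skolem functions\<close>

definition T :: "tm \<Rightarrow> tm \<Rightarrow> tm \<Rightarrow> fm" where
  "T a b c = \<^bold>\<not> (a \<^bold>\<noteq> b \<^bold>\<and> b \<^bold>\<noteq> c \<^bold>\<and> \<^bold>\<not> Btw a b c)"

definition Col :: "tm \<Rightarrow> tm \<Rightarrow> tm \<Rightarrow> fm" where
  "Col a b c = \<^bold>\<not> (\<^bold>\<not> T c a b \<^bold>\<and> \<^bold>\<not> T a c b \<^bold>\<and> \<^bold>\<not> T a b c)"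

definition SameOrder :: "tm \<Rightarrow> tm \<Rightarrow> tm \<Rightarrow> tm \<Rightarrow> fm" where
  "SameOrder a b c d =
     (T c a b \<^bold>\<longrightarrow> \<^bold>\<not> Btw d c a) \<^bold>\<and> (T a c b \<^bold>\<longrightarrow> \<^bold>\<not> Btw d c b) \<^bold>\<and> (T a b c \<^bold>\<longrightarrow> T a c d)"

text \<open>In this order: three congruence axioms, segment extension, five segments, irreflexivity of
  betweenness, inner Pasch, lower dimension, upper dimension, triangle circumscription, symmetry and
  inner transitivity of betweenness, and the two parts of the two-point line-circle axiom.
  The function symbols denote total functions; their terms are constrained only under the stated
  hypotheses.\<close>

definition axioms :: "fm set" where
  "axioms =
    (let a = Var 0; b = Var 1; c = Var 2; d = Var 3; p = Var 4; q = Var 5; r = Var 6; s = Var 7;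
         u = Var 8; v = Var 9; A = Var 10; B = Var 11; C = Var 12; D = Var 13
     in {
      Cong a b b a,
      Cong a b p q \<^bold>\<and> Cong a b r s \<^bold>\<longrightarrow> Cong p q r s,
      Cong a b c c \<^bold>\<longrightarrow> a \<^bold>= b,
      (let x = Ext q a b c in
        q \<^bold>\<noteq> a \<^bold>\<longrightarrow> T q a x \<^bold>\<and> Cong a x b c),
      a \<^bold>\<noteq> b \<^bold>\<and> T a b c \<^bold>\<and> T A B C \<^bold>\<and> Cong a b A B \<^bold>\<and> Cong b c B C \<^bold>\<and> Cong a d A D \<^bold>\<and> Cong b d B D
        \<^bold>\<longrightarrow> Cong c d C D,
      \<^bold>\<not> Btw a b a,
      (let x = Ip a p c b q in
        Btw a p c \<^bold>\<and> T b q c \<^bold>\<and> \<^bold>\<not> Col a b c \<^bold>\<longrightarrow> T p x b \<^bold>\<and> T q x a),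
      \<^bold>\<not> Col Alpha Beta Gamma,
      a \<^bold>\<noteq> b \<^bold>\<and> Cong p a p b \<^bold>\<and> Cong q a q b \<^bold>\<and> Cong r a r b \<^bold>\<longrightarrow> Col p q r,
      (let x = Center a b c in
        \<^bold>\<not> Col a b c \<^bold>\<longrightarrow> Cong a x b x \<^bold>\<and> Cong a x c x),
      Btw a b c \<^bold>\<longrightarrow> Btw c b a,
      Btw a b d \<^bold>\<and> Btw b c d \<^bold>\<longrightarrow> Btw a b c,
      (let y = Ilc1 u v a b; z = Ilc2 u v a b in
        Col u v p \<^bold>\<and> u \<^bold>\<noteq> v \<^bold>\<and> T a p b
        \<^bold>\<longrightarrow> Col u v y \<^bold>\<and> Col u v z \<^bold>\<and> Cong a y a b \<^bold>\<and> Cong a z a b \<^bold>\<and> T y p z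
          \<^bold>\<and> (p \<^bold>\<noteq> b \<^bold>\<longrightarrow> y \<^bold>\<noteq> z)),
      (let y = Ilc1 u v a b; z = Ilc2 u v a b in
        u \<^bold>\<noteq> v \<^bold>\<longrightarrow> SameOrder u v y z)
     })"

text \<open>The hypotheses of a derivation may share free variables with its conclusion, so the
  quantifier-free axioms enter as sentences, universally closed.\<close>

definition tarski :: "fm set" where
  "tarski = {(Forall ^^ k) p | k p. p \<in> axioms \<and> fv p \<subseteq> {..<k}}"

end

theory Submission
  imports Defs
begin

text \<open>This is Herbrand's theorem for a universal theory. If no finite disjunction of instances
  were provable, the theory together with \<open>P\<close> and all \<open>\<^bold>\<not> \<phi>\<langle>t\<rangle>\<close>, \<open>t\<close> a term in the
  variables of \<open>P\<close>, would be consistent. Extend it to a maximal consistent set \<open>M\<close>. The terms, with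
  the atoms belonging to \<open>M\<close> as the true ones, satisfy exactly those quantifier-free formulas that are
  in \<open>M\<close>, hence all universal axioms and \<open>P\<close>, but not \<open>Exists \<phi>\<close>; this contradicts soundness. Equality
  is interpreted by a congruence instead of passing to a quotient, and no witnesses for quantifiers
  are needed, because only quantifier-free formulas have to agree with \<open>M\<close>.\<close>

section \<open>Substitution\<close>

lemma subst_tm_comp: "subst_tm \<sigma> (subst_tm \<tau> t) = subst_tm (\<lambda>i. subst_tm \<sigma> (\<tau> i)) t"
  by (induction t) auto

lemma subst_tm_Var [simp]: "subst_tm Var t = t"
  by (induction t) auto

lemma subst_tm_cong: "(\<And>i. i \<in> fv_tm t \<Longrightarrow> \<sigma> i = \<tau> i) \<Longrightarrow> subst_tm \<sigma> t = subst_tm \<tau> t"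
  by (induction t) auto

lemma under_binder_comp:
  "subst_tm (under_binder \<sigma>) (under_binder \<tau> i) = under_binder (\<lambda>i. subst_tm \<sigma> (\<tau> i)) i"
  by (cases i) (simp_all add: under_binder_def subst_tm_comp)

lemma subst_comp: "subst \<sigma> (subst \<tau> p) = subst (\<lambda>i. subst_tm \<sigma> (\<tau> i)) p"
  by (induction p arbitrary: \<sigma> \<tau>) (simp_all add: subst_tm_comp under_binder_comp)

lemma subst_cong: "(\<And>i. i \<in> fv p \<Longrightarrow> \<sigma> i = \<tau> i) \<Longrightarrow> subst \<sigma> p = subst \<tau> p"
proof (induction p arbitrary: \<sigma> \<tau>)
  case (Forall p)
  have "subst (under_binder \<sigma>) p = subst (under_binder \<tau>) p"
    by (rule Forall.IH) (auto simp: under_binder_def Forall.prems split: nat.split)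
  then show ?case by simp
next
  case (Exists p)
  have "subst (under_binder \<sigma>) p = subst (under_binder \<tau>) p"
    by (rule Exists.IH) (auto simp: under_binder_def Exists.prems split: nat.split)
  then show ?case by simp
next
  case (And p q)
  then show ?case by (metis subst.simps(5) fv.simps(5) UnCI)
next
  case (Or p q)
  then show ?case by (metis subst.simps(6) fv.simps(6) UnCI)
next
  case (Imp p q)
  then show ?case by (metis subst.simps(7) fv.simps(7) UnCI)
qed (auto intro!: subst_tm_cong)

lemma under_binder_Var: "under_binder Var = Var"
  by (auto simp: under_binder_def split: nat.split)

lemma subst_Var [simp]: "subst Var p = p"
  by (induction p) (simp_all add: under_binder_Var)

text \<open>Instantiating the bound variable cancels the shift made by \<open>under_binder\<close>.
  This is what the quantifier cases need, both for derivations and for \<open>holds\<close>.\<close>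

lemma subst_tm_under_binder:
  "subst_tm (case_nat t \<sigma>) (under_binder \<tau> i) = case_nat t (\<lambda>i. subst_tm \<sigma> (\<tau> i)) i"
  by (cases i) (simp_all add: under_binder_def subst_tm_comp)

lemma inst_under_binder: "(subst (under_binder \<sigma>) p)\<langle>t\<rangle> = subst (case_nat t \<sigma>) p"
  by (simp add: inst_def subst_comp subst_tm_under_binder cong: nat.case_cong)

lemma fv_subst_tm: "fv_tm (subst_tm \<sigma> t) = (\<Union>i\<in>fv_tm t. fv_tm (\<sigma> i))"
  by (induction t) auto


section \<open>Derivations\<close>

lemma weaken: "\<Gamma> \<turnstile> p \<Longrightarrow> \<Gamma> \<subseteq> \<Delta> \<Longrightarrow> \<Delta> \<turnstile> p"
proof (induction arbitrary: \<Delta> rule: derivable.induct)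
  case (Assm p \<Gamma>)
  then show ?case by (blast intro: derivable.Assm)
next
  case (Classical p \<Gamma>)
  then show ?case by (meson derivable.Classical insert_mono)
next
  case (AndI \<Gamma> p q)
  then show ?case by (meson derivable.AndI)
next
  case (AndE1 \<Gamma> p q)
  then show ?case by (meson derivable.AndE1)
next
  case (AndE2 \<Gamma> p q)
  then show ?case by (meson derivable.AndE2)
next
  case (OrI1 \<Gamma> p q)
  then show ?case by (meson derivable.OrI1)
next
  case (OrI2 \<Gamma> q p)
  then show ?case by (meson derivable.OrI2)
next
  case (OrE \<Gamma> p q r)
  then show ?case by (meson derivable.OrE insert_mono)
next
  case (ImpI p \<Gamma> q)
  then show ?case by (meson derivable.ImpI insert_mono)
next
  case (ImpE \<Gamma> p q)
  then show ?case by (meson derivable.ImpE)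
next
  case (ForallI \<Gamma> p)
  then show ?case by (meson derivable.ForallI image_mono)
next
  case (ForallE \<Gamma> p t)
  then show ?case by (meson derivable.ForallE)
next
  case (ExistsI \<Gamma> p t)
  then show ?case by (meson derivable.ExistsI)
next
  case (ExistsE \<Gamma> p q)
  then show ?case by (meson derivable.ExistsE image_mono insert_mono)
next
  case (EqE \<Gamma> s t p)
  then show ?case by (meson derivable.EqE)
qed (rule EqI)

text \<open>Compactness of derivability: each rule has finitely many premises, so finite unions
  suffice once discharged hypotheses have been removed.\<close>

lemma derivable_finite: "\<Gamma> \<turnstile> p \<Longrightarrow> \<exists>\<Delta>\<subseteq>\<Gamma>. finite \<Delta> \<and> \<Delta> \<turnstile> p"
proof (induction rule: derivable.induct)
  case (Assm p \<Gamma>)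
  then show ?case by (intro exI[of _ "{p}"]) (auto intro: derivable.Assm)
next
  case (Classical p \<Gamma>)
  then obtain \<Delta> where *: "\<Delta> \<subseteq> insert (\<^bold>\<not> p) \<Gamma>" "finite \<Delta>" "\<Delta> \<turnstile> \<^bold>\<bottom>" by blast
  have "\<Delta> - {\<^bold>\<not> p} \<turnstile> p"
    by (rule derivable.Classical, rule weaken[OF *(3)]) blast
  with * show ?case by (intro exI[of _ "\<Delta> - {\<^bold>\<not> p}"]) auto
next
  case (AndI \<Gamma> p q)
  then obtain \<Delta> \<Delta>' where *: "\<Delta> \<subseteq> \<Gamma>" "finite \<Delta>" "\<Delta> \<turnstile> p" "\<Delta>' \<subseteq> \<Gamma>" "finite \<Delta>'" "\<Delta>' \<turnstile> q"
    by blast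
  have "\<Delta> \<union> \<Delta>' \<turnstile> p \<^bold>\<and> q"
    using weaken[OF *(3)] weaken[OF *(6)] by (intro derivable.AndI) auto
  with * show ?case by (intro exI[of _ "\<Delta> \<union> \<Delta>'"]) auto
next
  case (OrE \<Gamma> p q r)
  then obtain \<Delta> \<Delta>' \<Delta>'' where *: "\<Delta> \<subseteq> \<Gamma>" "finite \<Delta>" "\<Delta> \<turnstile> p \<^bold>\<or> q"
    "\<Delta>' \<subseteq> insert p \<Gamma>" "finite \<Delta>'" "\<Delta>' \<turnstile> r" "\<Delta>'' \<subseteq> insert q \<Gamma>" "finite \<Delta>''" "\<Delta>'' \<turnstile> r"
    by blast
  let ?\<Theta> = "\<Delta> \<union> (\<Delta>' - {p}) \<union> (\<Delta>'' - {q})"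
  have "?\<Theta> \<turnstile> r"
  proof (rule derivable.OrE)
    show "?\<Theta> \<turnstile> p \<^bold>\<or> q" using *(3) by (rule weaken) blast
    show "insert p ?\<Theta> \<turnstile> r" using *(6) by (rule weaken) blast
    show "insert q ?\<Theta> \<turnstile> r" using *(9) by (rule weaken) blast
  qed
  with * show ?case by (intro exI[of _ ?\<Theta>]) auto
next
  case (ImpI p \<Gamma> q)
  then obtain \<Delta> where *: "\<Delta> \<subseteq> insert p \<Gamma>" "finite \<Delta>" "\<Delta> \<turnstile> q" by blast
  have "\<Delta> - {p} \<turnstile> p \<^bold>\<longrightarrow> q"
    by (rule derivable.ImpI, rule weaken[OF *(3)]) blast
  with * show ?case by (intro exI[of _ "\<Delta> - {p}"]) auto
next
  case (ImpE \<Gamma> p q)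
  then obtain \<Delta> \<Delta>' where *: "\<Delta> \<subseteq> \<Gamma>" "finite \<Delta>" "\<Delta> \<turnstile> p \<^bold>\<longrightarrow> q" "\<Delta>' \<subseteq> \<Gamma>" "finite \<Delta>'" "\<Delta>' \<turnstile> p"
    by blast
  have "\<Delta> \<union> \<Delta>' \<turnstile> q"
    by (rule derivable.ImpE[OF weaken[OF *(3)] weaken[OF *(6)]]) auto
  with * show ?case by (intro exI[of _ "\<Delta> \<union> \<Delta>'"]) auto
next
  case (ForallI \<Gamma> p)
  then obtain \<Delta> where "\<Delta> \<subseteq> \<Gamma>" "finite \<Delta>" "shift ` \<Delta> \<turnstile> p"
    by (metis finite_subset_image)
  then show ?case by (blast intro: derivable.ForallI)
next
  case (ExistsE \<Gamma> p q)
  then obtain \<Delta> \<Delta>' where *: "\<Delta> \<subseteq> \<Gamma>" "finite \<Delta>" "\<Delta> \<turnstile> Exists p"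
    "\<Delta>' \<subseteq> insert p (shift ` \<Gamma>)" "finite \<Delta>'" "\<Delta>' \<turnstile> shift q"
    by blast
  \<comment> \<open>Without the eigenformula \<open>p\<close>, every remaining hypothesis is a
    shifted one and can be pulled back to a finite part of \<open>\<Gamma>\<close>.\<close>
  then have "\<Delta>' - {p} \<subseteq> shift ` \<Gamma>" "finite (\<Delta>' - {p})" by auto
  then obtain \<Theta> where \<Theta>: "\<Theta> \<subseteq> \<Gamma>" "finite \<Theta>" "\<Delta>' - {p} = shift ` \<Theta>"
    by (metis finite_subset_image)
  have "\<Delta> \<union> \<Theta> \<turnstile> q"
  proof (rule derivable.ExistsE)
    show "\<Delta> \<union> \<Theta> \<turnstile> Exists p" using *(3) by (rule weaken) blast
    show "insert p (shift ` (\<Delta> \<union> \<Theta>)) \<turnstile> shift q" using *(6) by (rule weaken) (use \<Theta>(3) in blast)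
  qed
  with * \<Theta> show ?case by (intro exI[of _ "\<Delta> \<union> \<Theta>"]) auto
next
  case (EqE \<Gamma> s t p)
  then obtain \<Delta> \<Delta>' where *: "\<Delta> \<subseteq> \<Gamma>" "finite \<Delta>" "\<Delta> \<turnstile> s \<^bold>= t" "\<Delta>' \<subseteq> \<Gamma>" "finite \<Delta>'" "\<Delta>' \<turnstile> p\<langle>s\<rangle>"
    by blast
  have "\<Delta> \<union> \<Delta>' \<turnstile> p\<langle>t\<rangle>"
    by (rule derivable.EqE[OF weaken[OF *(3)] weaken[OF *(6)]]) auto
  with * show ?case by (intro exI[of _ "\<Delta> \<union> \<Delta>'"]) auto
next
  case (AndE1 \<Gamma> p q)
  then show ?case by (meson derivable.AndE1)
next
  case (AndE2 \<Gamma> p q)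
  then show ?case by (meson derivable.AndE2)
next
  case (OrI1 \<Gamma> p q)
  then show ?case by (meson derivable.OrI1)
next
  case (OrI2 \<Gamma> q p)
  then show ?case by (meson derivable.OrI2)
next
  case (ForallE \<Gamma> p t)
  then show ?case by (meson derivable.ForallE)
next
  case (ExistsI \<Gamma> p t)
  then show ?case by (meson derivable.ExistsI)
next
  case (EqI \<Gamma> t)
  then show ?case by (meson derivable.EqI finite.emptyI empty_subsetI)
qed

text \<open>Extends \<open>EqE\<close>, which replaces only at index 0, to an arbitrary variable
  \<open>k\<close> under a simultaneous substitution.\<close>

lemma derivable_replace:
  assumes "\<Gamma> \<turnstile> s \<^bold>= t" and "\<Gamma> \<turnstile> subst (\<sigma>(k := s)) p"
  shows "\<Gamma> \<turnstile> subst (\<sigma>(k := t)) p"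
proof -
  \<comment> \<open>Index 0 becomes the hole for \<open>k\<close>. All other terms are shifted past
    it, so that instantiation restores them.\<close>
  define q where "q = subst (\<lambda>i. if i = k then Var 0 else subst_tm (\<lambda>j. Var (Suc j)) (\<sigma> i)) p"
  have "q\<langle>u\<rangle> = subst (\<sigma>(k := u)) p" for u
    unfolding q_def inst_def subst_comp by (rule subst_cong) (simp add: subst_tm_comp)
  then show ?thesis using EqE[of \<Gamma> s t q] assms by simp
qed

lemma derivable_closure_inst:
  assumes "\<Gamma> \<turnstile> (Forall ^^ k) p" and "fv p \<subseteq> {..<k}"
  shows "\<Gamma> \<turnstile> subst \<sigma> p"
proof -
  \<comment> \<open>Generalised to formulas with variables beyond the \<open>k\<close> quantifiers,
    since the induction exposes such formulas; these variables drop by \<open>k\<close>.\<close>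
  have "\<Gamma> \<turnstile> subst (\<lambda>i. if i < k then \<sigma> i else Var (i - k)) p"
    if "\<Gamma> \<turnstile> (Forall ^^ k) p" for k p \<sigma>
    using that
  proof (induction k arbitrary: p \<sigma>)
    case 0
    then show ?case by simp
  next
    case (Suc k)
    let ?\<rho> = "\<lambda>i. if i < k then \<sigma> (Suc i) else Var (i - k)"
    \<comment> \<open>The innermost quantifier is absorbed into the body. It binds index 0, so the
      outer ones receive \<open>\<sigma>\<close> from index 1 on, and \<open>\<sigma> 0\<close> is
      supplied last.\<close>
    have "\<Gamma> \<turnstile> (Forall ^^ k) (Forall p)"
      using Suc.prems by (simp add: funpow_swap1)
    from Suc.IH[OF this, of "\<lambda>i. \<sigma> (Suc i)"] have "\<Gamma> \<turnstile> Forall (subst (under_binder ?\<rho>) p)"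
      by simp
    then have "\<Gamma> \<turnstile> subst (case_nat (\<sigma> 0) ?\<rho>) p"
      using ForallE inst_under_binder by metis
    moreover have "case_nat (\<sigma> 0) ?\<rho> = (\<lambda>i. if i < Suc k then \<sigma> i else Var (i - Suc k))"
      by (auto split: nat.split)
    ultimately show ?case by simp
  qed
  moreover have "subst (\<lambda>i. if i < k then \<sigma> i else Var (i - k)) p = subst \<sigma> p"
    by (rule subst_cong) (use assms(2) in auto)
  ultimately show ?thesis using assms(1) by metis
qed

lemma derivable_OrI_classical:
  assumes "insert (\<^bold>\<not> p) \<Gamma> \<turnstile> q"
  shows "\<Gamma> \<turnstile> p \<^bold>\<or> q"
proof (rule Classical)
  let ?\<Delta> = "insert (\<^bold>\<not> (p \<^bold>\<or> q)) \<Gamma>"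
  have "insert (\<^bold>\<not> p) ?\<Delta> \<turnstile> q" using assms by (rule weaken) blast
  then have "insert (\<^bold>\<not> p) ?\<Delta> \<turnstile> \<^bold>\<bottom>" by (blast intro: ImpE OrI2 Assm)
  then have "?\<Delta> \<turnstile> p" by (rule Classical)
  then show "?\<Delta> \<turnstile> \<^bold>\<bottom>" by (blast intro: ImpE OrI1 Assm)
qed

text \<open>The context varies in the induction because each negated disjunct moves into it before
  the rest of the list is treated.\<close>

lemma derivable_big_or: "Neg ` set ps \<union> \<Gamma> \<turnstile> \<^bold>\<bottom> \<Longrightarrow> \<Gamma> \<turnstile> big_or ps"
proof (induction ps arbitrary: \<Gamma> rule: big_or.induct)
  case (2 p)
  then show ?case by (simp add: Classical)
next
  case (3 p q ps)
  then have "Neg ` set (q # ps) \<union> insert (\<^bold>\<not> p) \<Gamma> \<turnstile> \<^bold>\<bottom>" by simp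
  then have "insert (\<^bold>\<not> p) \<Gamma> \<turnstile> big_or (q # ps)" by (rule "3.IH")
  then show ?case by (simp add: derivable_OrI_classical)
qed simp


section \<open>Maximal consistent sets\<close>

definition max_consistent :: "fm set \<Rightarrow> bool" where
  "max_consistent M \<longleftrightarrow> \<not> M \<turnstile> \<^bold>\<bottom> \<and> (\<forall>p. p \<in> M \<or> insert p M \<turnstile> \<^bold>\<bottom>)"

text \<open>Zorn's lemma applies because a derivation of falsity from the union of a chain uses
  finitely many hypotheses, all lying in one member of the chain.\<close>

lemma max_consistent_extension:
  assumes "\<not> \<Gamma> \<turnstile> \<^bold>\<bottom>"
  obtains M where "\<Gamma> \<subseteq> M" and "max_consistent M"
proof -
  let ?C = "{\<Delta>. \<Gamma> \<subseteq> \<Delta> \<and> \<not> \<Delta> \<turnstile> \<^bold>\<bottom>}"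
  have "\<exists>M\<in>?C. \<forall>X\<in>?C. M \<subseteq> X \<longrightarrow> X = M"
  proof (rule subset_Zorn_nonempty)
    show "?C \<noteq> {}" using assms by auto
    fix \<C> assume ne: "\<C> \<noteq> {}" and ch: "subset.chain ?C \<C>"
    have "\<not> \<Union>\<C> \<turnstile> \<^bold>\<bottom>"
    proof
      assume "\<Union>\<C> \<turnstile> \<^bold>\<bottom>"
      then obtain \<Delta> where \<Delta>: "\<Delta> \<subseteq> \<Union>\<C>" "finite \<Delta>" "\<Delta> \<turnstile> \<^bold>\<bottom>"
        using derivable_finite by blast
      then obtain X where "X \<in> \<C>" "\<Delta> \<subseteq> X"
        using finite_subset_Union_chain[OF \<Delta>(2,1) ne ch] by blast
      with \<Delta>(3) ch show False by (auto simp: subset_chain_def dest: weaken)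
    qed
    moreover have "\<Gamma> \<subseteq> \<Union>\<C>" using ne ch unfolding subset_chain_def by blast
    ultimately show "\<Union>\<C> \<in> ?C" by simp
  qed
  then obtain M where M: "\<Gamma> \<subseteq> M" "\<not> M \<turnstile> \<^bold>\<bottom>"
    and max: "\<And>X. \<Gamma> \<subseteq> X \<Longrightarrow> \<not> X \<turnstile> \<^bold>\<bottom> \<Longrightarrow> M \<subseteq> X \<Longrightarrow> X = M" by auto
  have "p \<in> M \<or> insert p M \<turnstile> \<^bold>\<bottom>" for p
    using max[of "insert p M"] M(1) by blast
  with M that show thesis by (simp add: max_consistent_def)
qed

context
  fixes M assumes M: "max_consistent M"
begin

lemma max_consistent_Falsum: "\<not> M \<turnstile> \<^bold>\<bottom>"
  using M by (simp add: max_consistent_def)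

text \<open>Negation completeness, on which the clauses for implication and disjunction rest. Truth
  is phrased as derivability from \<open>M\<close> rather than membership, so the logical rules
  apply directly.\<close>

lemma max_consistent_Neg: "\<not> M \<turnstile> p \<Longrightarrow> M \<turnstile> \<^bold>\<not> p"
  using M unfolding max_consistent_def by (blast intro: Assm ImpI)

lemma max_consistent_And: "M \<turnstile> p \<^bold>\<and> q \<longleftrightarrow> M \<turnstile> p \<and> M \<turnstile> q"
  by (blast intro: AndI AndE1 AndE2)

lemma max_consistent_Imp: "M \<turnstile> p \<^bold>\<longrightarrow> q \<longleftrightarrow> (M \<turnstile> p \<longrightarrow> M \<turnstile> q)"
proof
  assume *: "M \<turnstile> p \<longrightarrow> M \<turnstile> q"
  show "M \<turnstile> p \<^bold>\<longrightarrow> q"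
  proof (cases "M \<turnstile> p")
    case True
    with * have "M \<turnstile> q" by simp
    then show ?thesis by (blast intro: ImpI weaken)
  next
    case False
    then have "M \<turnstile> \<^bold>\<not> p" by (rule max_consistent_Neg)
    then have "insert (\<^bold>\<not> q) (insert p M) \<turnstile> \<^bold>\<not> p" by (rule weaken) blast
    then show ?thesis by (blast intro: ImpI Classical ImpE Assm)
  qed
qed (blast intro: ImpE)

lemma max_consistent_Or: "M \<turnstile> p \<^bold>\<or> q \<longleftrightarrow> M \<turnstile> p \<or> M \<turnstile> q"
proof
  assume *: "M \<turnstile> p \<^bold>\<or> q"
  show "M \<turnstile> p \<or> M \<turnstile> q"
  proof (rule ccontr)
    assume "\<not> (M \<turnstile> p \<or> M \<turnstile> q)"
    then have "M \<turnstile> \<^bold>\<not> p" "M \<turnstile> \<^bold>\<not> q" by (simp_all add: max_consistent_Neg)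
    then have "insert p M \<turnstile> \<^bold>\<bottom>" "insert q M \<turnstile> \<^bold>\<bottom>"
      by (blast intro: ImpE Assm weaken)+
    with * have "M \<turnstile> \<^bold>\<bottom>" by (rule OrE)
    with max_consistent_Falsum show False by simp
  qed
qed (blast intro: OrI1 OrI2)

end


section \<open>Herbrand interpretations\<close>

text \<open>The universe is the set of all terms, with the function symbols interpreted as themselves;
  \<open>H\<close> is only consulted on atoms.\<close>

primrec holds :: "(fm \<Rightarrow> bool) \<Rightarrow> (nat \<Rightarrow> tm) \<Rightarrow> fm \<Rightarrow> bool" where
  "holds H e (s \<^bold>= t) = H (subst e (s \<^bold>= t))"
| "holds H e (Btw a b c) = H (subst e (Btw a b c))"
| "holds H e (Cong a b c d) = H (subst e (Cong a b c d))"
| "holds H e \<^bold>\<bottom> = False"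
| "holds H e (p \<^bold>\<and> q) = (holds H e p \<and> holds H e q)"
| "holds H e (p \<^bold>\<or> q) = (holds H e p \<or> holds H e q)"
| "holds H e (p \<^bold>\<longrightarrow> q) = (holds H e p \<longrightarrow> holds H e q)"
| "holds H e (Forall p) = (\<forall>t. holds H (case_nat t e) p)"
| "holds H e (Exists p) = (\<exists>t. holds H (case_nat t e) p)"

lemma holds_subst: "holds H e (subst \<sigma> p) = holds H (\<lambda>i. subst_tm e (\<sigma> i)) p"
  by (induction p arbitrary: e \<sigma>) (simp_all add: subst_tm_comp subst_tm_under_binder)

lemma holds_shift: "holds H (case_nat t e) (shift p) = holds H e p"
  by (simp add: shift_def holds_subst)

lemma holds_inst: "holds H e (p\<langle>t\<rangle>) = holds H (case_nat (subst_tm e t) e) p"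
proof -
  have "(\<lambda>i. subst_tm e (case_nat t Var i)) = case_nat (subst_tm e t) e"
    by (auto split: nat.split)
  then show ?thesis by (simp add: inst_def holds_subst)
qed

lemma holds_closure: "(\<And>e. holds H e p) \<Longrightarrow> holds H e ((Forall ^^ k) p)"
  by (induction k arbitrary: e) simp_all

text \<open>Leibniz replacement in one variable makes equality a congruence for all function and
  relation symbols at once.\<close>

locale herbrand =
  fixes H :: "fm \<Rightarrow> bool"
  assumes H_refl: "H (t \<^bold>= t)"
    and H_replace: "H (s \<^bold>= t) \<Longrightarrow> H (subst (\<sigma>(k := s)) p) \<Longrightarrow> H (subst (\<sigma>(k := t)) p)"
begin

lemma H_sym: "H (s \<^bold>= t) \<Longrightarrow> H (t \<^bold>= s)"
  using H_replace[of s t "\<lambda>_. s" 0 "Var 0 \<^bold>= Var 1"] H_refl by simp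

lemma H_replace_iff: "H (s \<^bold>= t) \<Longrightarrow> H (subst (\<sigma>(k := s)) p) = H (subst (\<sigma>(k := t)) p)"
  using H_replace H_sym by blast

lemma holds_replace: "H (s \<^bold>= t) \<Longrightarrow> holds H (e(k := s)) p = holds H (e(k := t)) p"
proof (induction p arbitrary: e k)
  case (Forall p)
  \<comment> \<open>Below a binder the updated variable moves up by one.\<close>
  have "case_nat u (e(k := v)) = (case_nat u e)(Suc k := v)" for u v
    by (auto split: nat.split)
  then show ?case by (simp only: holds.simps Forall.IH[OF Forall.prems])
next
  case (Exists p)
  have "case_nat u (e(k := v)) = (case_nat u e)(Suc k := v)" for u v
    by (auto split: nat.split)
  then show ?case by (simp only: holds.simps Exists.IH[OF Exists.prems])
qed (simp_all only: holds.simps H_replace_iff)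

text \<open>Hypotheses and conclusion share one valuation, because hypotheses may have free
  variables. It stays arbitrary in the induction, since the quantifier rules extend it.\<close>

lemma soundness: "\<Gamma> \<turnstile> p \<Longrightarrow> \<forall>q\<in>\<Gamma>. holds H e q \<Longrightarrow> holds H e p"
proof (induction arbitrary: e rule: derivable.induct)
  case (Classical p \<Gamma>)
  show ?case
  proof (rule ccontr)
    assume "\<not> holds H e p"
    then show False using Classical.IH[of e] Classical.prems by simp
  qed
next
  case (OrE \<Gamma> p q r)
  from OrE.IH(1)[OF OrE.prems] have "holds H e p \<or> holds H e q" by simp
  then show ?case using OrE.IH(2,3)[of e] OrE.prems by auto
next
  case (ImpE \<Gamma> p q)
  then show ?case using ImpE.IH[of e] by simp
next
  case (ForallI \<Gamma> p)
  have "holds H (case_nat t e) p" for t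
    by (rule ForallI.IH) (auto simp: holds_shift ForallI.prems)
  then show ?case by simp
next
  case (ForallE \<Gamma> p t)
  then show ?case by (simp add: holds_inst)
next
  case (ExistsI \<Gamma> p t)
  from ExistsI.IH[OF ExistsI.prems] show ?case by (auto simp: holds_inst)
next
  case (ExistsE \<Gamma> p q)
  from ExistsE.IH(1)[OF ExistsE.prems] obtain t where t: "holds H (case_nat t e) p" by auto
  have "holds H (case_nat t e) (shift q)"
    by (rule ExistsE.IH(2)) (auto simp: holds_shift t ExistsE.prems)
  then show ?case by (simp add: holds_shift)
next
  case (EqI \<Gamma> t)
  then show ?case by (simp add: H_refl)
next
  case (EqE \<Gamma> s t p)
  \<comment> \<open>\<open>Alpha\<close> is a dummy at index 0, always overwritten; it brings both
    instances into the form of an update.\<close>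
  have upd: "(case_nat Alpha e)(0 := u) = case_nat u e" for u
    by (auto split: nat.split)
  have "H (subst_tm e s \<^bold>= subst_tm e t)" "holds H e (p\<langle>s\<rangle>)"
    using EqE.IH[OF EqE.prems] by simp_all
  then show ?case
    using holds_replace[of "subst_tm e s" "subst_tm e t" "case_nat Alpha e" 0 p]
    by (simp only: holds_inst upd)
qed simp_all

end

text \<open>Applying \<open>\<sigma>\<close> first makes the Herbrand interpretation see only terms from the range of
  \<open>\<sigma>\<close>, so that no restriction of its universe is needed.\<close>

lemma herbrand_derivable: "herbrand (\<lambda>p. \<Gamma> \<turnstile> subst \<sigma> p)"
proof
  show "\<Gamma> \<turnstile> subst \<sigma> (t \<^bold>= t)" for t by (simp add: EqI)
next
  fix s t \<tau> k p
  assume *: "\<Gamma> \<turnstile> subst \<sigma> (s \<^bold>= t)" "\<Gamma> \<turnstile> subst \<sigma> (subst (\<tau>(k := s)) p)"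
  have "subst \<sigma> (subst (\<tau>(k := u)) p) = subst ((\<lambda>i. subst_tm \<sigma> (\<tau> i))(k := subst_tm \<sigma> u)) p" for u
    unfolding subst_comp by (rule subst_cong) simp
  then show "\<Gamma> \<turnstile> subst \<sigma> (subst (\<tau>(k := t)) p)"
    using * derivable_replace by simp
qed

text \<open>The truth lemma: atoms agree by definition of the interpretation, connectives by the
  properties of \<open>M\<close>.\<close>

lemma holds_max_consistent:
  assumes "max_consistent M" and "quantifier_free p"
  shows "holds (\<lambda>p. M \<turnstile> subst \<sigma> p) e p \<longleftrightarrow> M \<turnstile> subst \<sigma> (subst e p)"
  using assms(2)
  by (induction p)
    (simp_all add: max_consistent_Falsum[OF assms(1)] max_consistent_And[OF assms(1)]
      max_consistent_Or[OF assms(1)] max_consistent_Imp[OF assms(1)])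


section \<open>Herbrand's theorem\<close>

definition closures :: "fm set \<Rightarrow> fm set" where
  "closures A = {(Forall ^^ k) p | k p. p \<in> A \<and> fv p \<subseteq> {..<k}}"

lemma universal_theory_inconsistent:
  assumes A: "\<And>p. p \<in> A \<Longrightarrow> quantifier_free p"
    and P: "quantifier_free P" "fv P \<subseteq> {..<m}"
    and \<phi>: "quantifier_free \<phi>" "fv \<phi> \<subseteq> {..<Suc m}"
    and prov: "closures A \<turnstile> P \<^bold>\<longrightarrow> Exists \<phi>"
  shows "insert P (closures A) \<union> {\<^bold>\<not> \<phi>\<langle>t\<rangle> | t. fv_tm t \<subseteq> {..<m}} \<turnstile> \<^bold>\<bottom>" (is "?\<Gamma> \<turnstile> _")
proof (rule ccontr)
  assume "\<not> ?\<Gamma> \<turnstile> \<^bold>\<bottom>"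
  then obtain M where M: "?\<Gamma> \<subseteq> M" "max_consistent M" by (rule max_consistent_extension)
  \<comment> \<open>The closed term \<open>Alpha\<close> replaces every variable from
    \<open>m\<close> on, so that any witness found in the model becomes a term in the first
    \<open>m\<close> variables.\<close>
  define \<sigma> where "\<sigma> = (\<lambda>i. if i < m then Var i else Alpha)"
  define H where "H = (\<lambda>p. M \<turnstile> subst \<sigma> p)"
  interpret herbrand H unfolding H_def by (rule herbrand_derivable)
  note truth = holds_max_consistent[OF M(2), of _ \<sigma>, folded H_def]

  have "holds H Var q" if "q \<in> closures A" for q
  proof -
    from that obtain k p where p: "p \<in> A" "fv p \<subseteq> {..<k}" and q: "q = (Forall ^^ k) p"
      by (auto simp: closures_def)
    \<comment> \<open>All instances of the matrix are derivable from \<open>M\<close>, so by the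
      truth lemma it holds under every valuation, and the universal closure holds too.\<close>
    have "M \<turnstile> q" using that M(1) by (blast intro: Assm)
    then have "holds H e p" for e
      using truth[OF A[OF p(1)]] derivable_closure_inst[OF _ p(2)] by (simp add: q subst_comp)
    then show ?thesis unfolding q by (rule holds_closure)
  qed
  with soundness[OF prov] have "holds H Var (P \<^bold>\<longrightarrow> Exists \<phi>)" by blast
  moreover have "subst \<sigma> P = subst Var P"
    by (rule subst_cong) (use P(2) in \<open>auto simp: \<sigma>_def\<close>)
  then have "holds H Var P"
    using M(1) by (simp add: truth[OF P(1)] Assm)
  ultimately obtain t where "holds H (case_nat t Var) \<phi>" by auto
  then have "M \<turnstile> subst \<sigma> (subst (case_nat t Var) \<phi>)" by (simp add: truth[OF \<phi>(1)])
  \<comment> \<open>Apart from the witness at index 0, \<open>\<phi>\<close> sees only variables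
    that \<open>\<sigma>\<close> fixes, so \<open>\<sigma>\<close> acts on \<open>t\<close>
    alone.\<close>
  moreover have "subst \<sigma> (subst (case_nat t Var) \<phi>) = \<phi>\<langle>subst_tm \<sigma> t\<rangle>"
    unfolding inst_def subst_comp
    by (rule subst_cong) (use \<phi>(2) in \<open>auto simp: \<sigma>_def split: nat.split\<close>)
  ultimately have "M \<turnstile> \<phi>\<langle>subst_tm \<sigma> t\<rangle>" by simp
  moreover have "fv_tm (subst_tm \<sigma> t) \<subseteq> {..<m}"
    by (auto simp: fv_subst_tm \<sigma>_def split: if_splits)
  then have "M \<turnstile> \<^bold>\<not> \<phi>\<langle>subst_tm \<sigma> t\<rangle>"
    using M(1) by (blast intro: Assm)
  ultimately have "M \<turnstile> \<^bold>\<bottom>" by (blast intro: ImpE)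
  with max_consistent_Falsum[OF M(2)] show False by simp
qed

theorem herbrand_theorem:
  assumes A: "\<And>p. p \<in> A \<Longrightarrow> quantifier_free p"
    and P: "quantifier_free P" "fv P \<subseteq> {..<m}"
    and \<phi>: "quantifier_free \<phi>" "fv \<phi> \<subseteq> {..<Suc m}"
    and prov: "closures A \<turnstile> P \<^bold>\<longrightarrow> Exists \<phi>"
  shows "\<exists>ts. ts \<noteq> [] \<and> (\<forall>t \<in> set ts. fv_tm t \<subseteq> {..<m})
           \<and> closures A \<turnstile> P \<^bold>\<longrightarrow> big_or (map (\<lambda>t. \<phi>\<langle>t\<rangle>) ts)"
proof -
  let ?N = "\<lambda>t. \<^bold>\<not> \<phi>\<langle>t\<rangle>" and ?\<Delta> = "insert P (closures A)"
  obtain F where F: "F \<subseteq> ?\<Delta> \<union> {?N t | t. fv_tm t \<subseteq> {..<m}}" "finite F" "F \<turnstile> \<^bold>\<bottom>"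
    using derivable_finite[OF universal_theory_inconsistent[OF assms]] by blast
  \<comment> \<open>The hypotheses in \<open>F\<close> outside \<open>?\<Delta>\<close> are negated
    instances; choosing a term for each gives the finite set \<open>S\<close>.\<close>
  have "F - ?\<Delta> \<subseteq> ?N ` {t. fv_tm t \<subseteq> {..<m}}" "finite (F - ?\<Delta>)" using F(1,2) by auto
  then obtain S where S: "S \<subseteq> {t. fv_tm t \<subseteq> {..<m}}" "finite S" "F - ?\<Delta> = ?N ` S"
    by (metis finite_subset_image)
  from \<open>finite S\<close> obtain ts where ts: "set ts = S" using finite_list by blast
  \<comment> \<open>Adding \<open>Alpha\<close> makes the list nonempty; its extra negated instance
    enters by weakening.\<close>
  have "Neg ` set (map (\<lambda>t. \<phi>\<langle>t\<rangle>) (Alpha # ts)) \<union> ?\<Delta> \<turnstile> \<^bold>\<bottom>"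
    using F(3) by (rule weaken) (use S(3) ts in \<open>auto simp: image_image\<close>)
  then have "closures A \<turnstile> P \<^bold>\<longrightarrow> big_or (map (\<lambda>t. \<phi>\<langle>t\<rangle>) (Alpha # ts))"
    by (intro ImpI derivable_big_or)
  moreover have "\<forall>t \<in> set (Alpha # ts). fv_tm t \<subseteq> {..<m}"
    using S(1) ts by auto
  ultimately show ?thesis by blast
qed

text \<open>Here the Skolem functions matter: existence axioms name their witnesses by terms, which
  makes the theory universal.\<close>

lemma quantifier_free_axioms: "p \<in> axioms \<Longrightarrow> quantifier_free p"
  by (auto simp: axioms_def Let_def T_def Col_def SameOrder_def)

theorem theorem13p3:
  fixes m :: nat and P \<phi> :: fm
  assumes "quantifier_free P" and "disjunction_free P" and "fv P \<subseteq> {..<m}"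
    and "quantifier_free \<phi>" and "fv \<phi> \<subseteq> {..<Suc m}"
    and "tarski \<turnstile> P \<^bold>\<longrightarrow> Exists \<phi>"
  shows "\<exists>ts. ts \<noteq> [] \<and> (\<forall>t \<in> set ts. fv_tm t \<subseteq> {..<m})
           \<and> tarski \<turnstile> P \<^bold>\<longrightarrow> big_or (map (\<lambda>t. \<phi>\<langle>t\<rangle>) ts)"
proof -
  have tarski: "tarski = closures axioms" by (simp add: tarski_def closures_def)
  show ?thesis
    unfolding tarski
    by (rule herbrand_theorem) (use assms quantifier_free_axioms in \<open>auto simp: tarski\<close>)
qed

end
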